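(* Let $N$ be such that $\Gamma_0(N)$ has genus zero and let $\pi_N(z)$ be a Hauptmodul for $\Gamma_0(N)$. Then there are polynomials $P_{N,n}$ ($n\ge1$), with $P_{N,n}$ of degree $n$, such that for $\mathrm{Im}(z_1)\gg\mathrm{Im}(z_2)$ $$-\frac{1}{2\pi i}\,\frac{\pi_N'(z_1)}{\pi_N(z_1)-\pi_N(z_2)}=1+\sum_{n=1}^{\infty}P_{N,n}(\pi_N(z_2))\,q_1^n .$$ Moreover $P_{N,n}(\pi_N(z_2))=q_2^{-n}+O(q_2)$.
   Context: $z_1,z_2$ are in the upper half plane, $q_j=\exp(2\pi i z_j)$, and $'$ denotes the derivative $d/dz_1$. A Hauptmodul for the genus zero group $\Gamma_0(N)$ is a generator $\pi_N$ of the function field of $X_0(N)$, a modular function for $\Gamma_0(N)$ holomorphic on the upper half plane whose only pole is a simple pole at the cusp $i\infty$, with expansion $q^{-1}+c(0)+c(1)q+\cdots$, $q=\exp(2\pi i z)$. The condition $\mathrm{Im}(z_1)\gg\mathrm{Im}(z_2)$ means that $\mathrm{Im}(z_1)$ is sufficiently large relative to $z_2$. The statement $P_{N,n}(\pi_N(z_2))=q_2^{-n}+O(q_2)$ refers to the $q_2$-expansion at $i\infty$; in particular the constant term vanishes. *)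

theory Defs
  imports "HOL-Complex_Analysis.Complex_Analysis"
begin

definition upper_half_plane :: "complex set" where
  "upper_half_plane = {z. Im z > 0}"

definition SL2Z :: "(int^2^2) set" where
  "SL2Z = {A. det A = 1}"

definition Gamma0 :: "nat \<Rightarrow> (int^2^2) set" where
  "Gamma0 N = {A \<in> SL2Z. int N dvd A $ 2 $ 1}"

definition moebius :: "int^2^2 \<Rightarrow> complex \<Rightarrow> complex" where
  "moebius A z = (of_int (A $ 1 $ 1) * z + of_int (A $ 1 $ 2)) /
                 (of_int (A $ 2 $ 1) * z + of_int (A $ 2 $ 2))"

definition nome :: "complex \<Rightarrow> complex" where
  "nome z = exp (2 * of_real pi * \<i> * z)"


subsection \<open>The modular curve as a topological space\<close>

text \<open>
  Points of the Riemann sphere are encoded as \<^typ>\<open>complex option\<close>, with \<^term>\<open>None\<close>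
  the point at infinity.
\<close>

definition moebius_ext :: "int^2^2 \<Rightarrow> complex option \<Rightarrow> complex option" where
  "moebius_ext A x =
     (case x of
        None \<Rightarrow> if A $ 2 $ 1 = 0 then None else Some (of_int (A $ 1 $ 1) / of_int (A $ 2 $ 1))
      | Some z \<Rightarrow> if of_int (A $ 2 $ 1) * z + of_int (A $ 2 $ 2) = 0 then None
                  else Some (moebius A z))"

text \<open>
  The topology on the union of the upper half plane and the cusps (the rationals and infinity):
  it is generated by the open subsets of the upper half plane and by the images under
  \<^term>\<open>SL2Z\<close> of the neighbourhoods \<open>{z. Im z > T} \<union> {\<infinity>}\<close> of infinity (for a rational cusp these
  images are horodiscs tangent to the real axis at the cusp, together with the cusp).
\<close>

definition extended_upper_half_plane :: "complex option topology" where
  "extended_upper_half_plane = topology_generated_by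
     ({Some ` U | U. open U \<and> U \<subseteq> upper_half_plane} \<union>
      {moebius_ext A ` insert None (Some ` {z. Im z > T}) | A T. A \<in> SL2Z \<and> T > 0})"

definition Gamma0_orbit :: "nat \<Rightarrow> complex option \<Rightarrow> complex option set" where
  "Gamma0_orbit N x = (\<lambda>A. moebius_ext A x) ` Gamma0 N"

text \<open>The quotient topology on the image of a map \<open>f\<close>.\<close>

definition quotient_topology :: "'a topology \<Rightarrow> ('a \<Rightarrow> 'b) \<Rightarrow> 'b topology" where
  "quotient_topology X f =
     topology (\<lambda>U. U \<subseteq> f ` topspace X \<and> openin X {x \<in> topspace X. f x \<in> U})"

lemma openin_quotient_topology:
  "openin (quotient_topology X f) U \<longleftrightarrow>
     U \<subseteq> f ` topspace X \<and> openin X {x \<in> topspace X. f x \<in> U}"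
proof -
  have "istopology (\<lambda>U. U \<subseteq> f ` topspace X \<and> openin X {x \<in> topspace X. f x \<in> U})"
    unfolding istopology_def
  proof (intro conjI allI impI)
    fix S T
    assume *: "S \<subseteq> f ` topspace X \<and> openin X {x \<in> topspace X. f x \<in> S}"
              "T \<subseteq> f ` topspace X \<and> openin X {x \<in> topspace X. f x \<in> T}"
    have "{x \<in> topspace X. f x \<in> S \<inter> T} =
            {x \<in> topspace X. f x \<in> S} \<inter> {x \<in> topspace X. f x \<in> T}" by auto
    with * show "openin X {x \<in> topspace X. f x \<in> S \<inter> T}" by (simp only: openin_Int)
    from * show "S \<inter> T \<subseteq> f ` topspace X" by blast
  next
    fix K
    assume *: "\<forall>U\<in>K. U \<subseteq> f ` topspace X \<and> openin X {x \<in> topspace X. f x \<in> U}"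
    have "{x \<in> topspace X. f x \<in> \<Union>K} = (\<Union>U\<in>K. {x \<in> topspace X. f x \<in> U})" by auto
    moreover have "openin X (\<Union>U\<in>K. {x \<in> topspace X. f x \<in> U})"
      using * by (intro openin_Union) blast
    ultimately show "openin X {x \<in> topspace X. f x \<in> \<Union>K}" by (simp only:)
    from * show "\<Union>K \<subseteq> f ` topspace X" by blast
  qed
  then show ?thesis
    unfolding quotient_topology_def by (simp only: topology_inverse')
qed

lemma quotient_map_quotient_topology: "quotient_map X (quotient_topology X f) f"
proof -
  have "topspace (quotient_topology X f) = f ` topspace X"
  proof (rule antisym)
    show "topspace (quotient_topology X f) \<subseteq> f ` topspace X"
      using openin_topspace[of "quotient_topology X f"]
      by (simp only: openin_quotient_topology)
    have "{x \<in> topspace X. f x \<in> f ` topspace X} = topspace X" by auto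
    then show "f ` topspace X \<subseteq> topspace (quotient_topology X f)"
      by (intro openin_subset) (simp only: openin_quotient_topology subset_refl openin_topspace)
  qed
  then show ?thesis
    unfolding quotient_map_def openin_quotient_topology by blast
qed

definition X0 :: "nat \<Rightarrow> complex option set topology" where
  "X0 N = quotient_topology extended_upper_half_plane (Gamma0_orbit N)"

definition genus_zero :: "nat \<Rightarrow> bool" where
  "genus_zero N \<longleftrightarrow> X0 N homeomorphic_space nsphere 2"


subsection \<open>Modular functions and Hauptmoduln\<close>

text \<open>
  \<open>cusp_expansion N f A F\<close>: near the cusp \<open>A \<infinity>\<close> the function \<open>f\<close> is given by \<open>F\<close> in the variable
  \<open>exp (2 \<pi> i z / N)\<close>. The width of every cusp of \<^term>\<open>Gamma0 N\<close> divides \<open>N\<close>, so this variable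
  is available at all cusps; it is a root of the local parameter, which does not affect
  whether \<open>F\<close> is meromorphic or holomorphic at 0.
\<close>

definition cusp_expansion ::
    "nat \<Rightarrow> (complex \<Rightarrow> complex) \<Rightarrow> int^2^2 \<Rightarrow> (complex \<Rightarrow> complex) \<Rightarrow> bool" where
  "cusp_expansion N f A F \<longleftrightarrow>
     (\<exists>T>0. \<forall>z. Im z > T \<longrightarrow> f (moebius A z) = F (nome (z / of_nat N)))"

text \<open>
  \<open>nicely_meromorphic_on\<close> excludes spurious values at isolated points, so that each element of the
  function field of \<open>X0 N\<close> has exactly one representative on the upper half plane (taking the
  value 0 at its poles there).
\<close>

definition modular_function :: "nat \<Rightarrow> (complex \<Rightarrow> complex) \<Rightarrow> bool" where
  "modular_function N f \<longleftrightarrow>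
     f nicely_meromorphic_on upper_half_plane \<and>
     (\<forall>A\<in>Gamma0 N. \<forall>z\<in>upper_half_plane. f (moebius A z) = f z) \<and>
     (\<forall>A\<in>SL2Z. \<exists>F. F meromorphic_on {0} \<and> cusp_expansion N f A F)"

definition generates_function_field :: "nat \<Rightarrow> (complex \<Rightarrow> complex) \<Rightarrow> bool" where
  "generates_function_field N f \<longleftrightarrow>
     (\<forall>g. modular_function N g \<longrightarrow>
        (\<exists>p r. r \<noteq> 0 \<and> (\<forall>\<^sub>\<approx>z\<in>upper_half_plane. g z = poly p (f z) / poly r (f z))))"

text \<open>
  In \<open>hauptmodul\<close>, the last conjunct is the expansion \<open>q\<^sup>-\<^sup>1 + c(0) + c(1) q + \<dots>\<close> at \<open>\<infinity>\<close>; it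
  contains the statement that the pole there is simple.
\<close>

definition hauptmodul :: "nat \<Rightarrow> (complex \<Rightarrow> complex) \<Rightarrow> bool" where
  "hauptmodul N f \<longleftrightarrow>
     modular_function N f \<and>
     generates_function_field N f \<and>
     f holomorphic_on upper_half_plane \<and>
     (\<forall>A\<in>SL2Z. moebius_ext A None \<notin> Gamma0_orbit N None \<longrightarrow>
        (\<exists>F. F analytic_on {0} \<and> cusp_expansion N f A F)) \<and>
     (\<exists>c :: nat \<Rightarrow> complex. \<forall>z\<in>upper_half_plane.
        (\<lambda>n. c n * nome z ^ n) sums (f z - inverse (nome z)))"

end

theory Submission
  imports Defs
begin

text \<open>
  Write \<open>p = q\<^sub>1\<close>, \<open>q = q\<^sub>2\<close> for the two nomes, \<open>w\<close> for the value of the Hauptmodul at \<open>z\<^sub>2\<close>, and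
  \<open>1/p + C(p)\<close> with \<open>C(p) = \<Sum>c\<^sub>n p\<^sup>n\<close> for the expansion at infinity. Since \<open>d/dz\<^sub>1 = 2\<pi>i p d/dp\<close>, the
  left-hand side of the identity becomes

    \<open>(1 - p\<^sup>2 C'(p)) / (1 + p (C(p) - w))\<close>.

  The denominator has constant term 1, so this is a power series in \<open>p\<close> near 0, and multiplying out
  gives a recursion for its coefficients: they are monic polynomials of degree \<open>n\<close> in \<open>w\<close>, the Faber
  polynomials of the expansion (\<open>faber_poly_generating_function\<close>, \<open>degree_lead_coeff_faber_poly\<close>,
  \<open>fps_divide_sums_near_0\<close>).

  For the behaviour in \<open>q\<close>, put \<open>w = 1/q + C(q)\<close>. The denominator \<open>H(p)\<close> vanishes at \<open>p = q\<close> and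
  factors as \<open>H(p) = (1 - p/q) (1 - E(p))\<close>, where the coefficients of \<open>E\<close> are the tails
  \<open>t\<^sub>k = c\<^sub>k q + c\<^sub>k\<^sub>+\<^sub>1 q\<^sup>2 + \<dots>\<close> with \<open>k \<ge> 1\<close>. The numerator is \<open>H - p H'\<close>, so the quotient is
  \<open>1 - p H'/H\<close>, and the logarithmic derivative splits:

    \<open>1 - p H'/H = 1 / (1 - p/q) + p E' / (1 - E)\<close>.

  The first summand contributes exactly \<open>q\<^sup>-\<^sup>n\<close>. The coefficients of the second are polynomials without
  constant term in the tails, hence holomorphic in \<open>|q| < 1\<close> and zero at \<open>q = 0\<close>
  (\<open>poly_faber_poly_eq\<close>, \<open>holomorphic_faber_rem\<close>). This is the claim \<open>q\<^sup>-\<^sup>n + O(q)\<close>, with a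
  remainder expansion valid on the whole upper half plane.
\<close>

section \<open>Faber polynomials as formal objects\<close>

text \<open>
  The recursion compares coefficients of \<open>p\<^sup>n\<^sup>+\<^sup>1\<close> in the identity of
  \<open>faber_poly_generating_function\<close> below.
\<close>

fun faber_poly :: "(nat \<Rightarrow> 'a::comm_ring_1) \<Rightarrow> nat \<Rightarrow> 'a poly" where
  "faber_poly c 0 = 1"
| "faber_poly c (Suc n) =
     [:0, 1:] * faber_poly c n - (\<Sum>k\<le>n. smult (c k) (faber_poly c (n - k))) - [:of_nat n * c n:]"

text \<open>
  In the recursion only the product with the variable reaches degree \<open>n + 1\<close>. Carrying the leading
  coefficient along in the induction guarantees that this product is nonzero.
\<close>

lemma degree_lead_coeff_faber_poly:
  "degree (faber_poly c n) = n \<and> lead_coeff (faber_poly c n) = 1"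
proof (induction n rule: less_induct)
  case (less n)
  show ?case
  proof (cases n)
    case 0
    then show ?thesis by simp
  next
    case (Suc m)
    define R where
      "R = - (\<Sum>k\<le>m. smult (c k) (faber_poly c (m - k))) - [:of_nat m * c m:]"
    have IH: "degree (faber_poly c m) = m" "lead_coeff (faber_poly c m) = 1"
      using less.IH[of m] Suc by blast+
    have "degree (\<Sum>k\<le>m. smult (c k) (faber_poly c (m - k))) \<le> m"
    proof (rule degree_sum_le)
      fix k assume "k \<in> {..m}"
      then have "degree (faber_poly c (m - k)) = m - k"
        using less Suc by auto
      then show "degree (smult (c k) (faber_poly c (m - k))) \<le> m"
        by (metis degree_smult_le diff_le_self order_trans)
    qed simp
    then have R: "degree R \<le> m"
      unfolding R_def by (intro degree_diff_le) auto
    have P: "faber_poly c n = pCons 0 (faber_poly c m) + R"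
      by (simp add: Suc R_def)
    have nz: "faber_poly c m \<noteq> 0" using IH by auto
    then have d: "degree (pCons 0 (faber_poly c m)) = n"
      by (simp add: Suc IH)
    have "degree R < degree (pCons 0 (faber_poly c m))"
      using R d Suc by simp
    then have D: "degree (faber_poly c n) = n"
      unfolding P using d by (simp add: degree_add_eq_left)
    have "coeff R (Suc m) = 0"
      using R by (intro coeff_eq_0) simp
    then have "lead_coeff (faber_poly c n) = 1"
      unfolding D unfolding P by (simp add: Suc) (use IH in simp)
    with D show ?thesis by simp
  qed
qed

text \<open>
  Stated as a product, the identity is polynomial in \<open>w\<close> and the \<open>c\<^sub>n\<close>. The right-hand side is
  \<open>H - p H'\<close> for the factor \<open>H\<close> on the left: the term linear in \<open>p\<close>, and with it the value \<open>w\<close>,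
  cancels.
\<close>

lemma faber_poly_generating_function:
  fixes c :: "nat \<Rightarrow> 'a::comm_ring_1"
  shows "Abs_fps (\<lambda>n. poly (faber_poly c n) w) * (1 + fps_X * (Abs_fps c - fps_const w)) =
    1 - fps_X\<^sup>2 * fps_deriv (Abs_fps c)"
    (is "?P * _ = _")
proof -
  have eq: "?P * (1 + fps_X * (Abs_fps c - fps_const w)) =
      ?P + fps_X * (Abs_fps c * ?P - fps_const w * ?P)"
    by (simp add: algebra_simps)
  show ?thesis
    unfolding eq
  proof (rule fps_ext)
    fix n
    show "(?P + fps_X * (Abs_fps c * ?P - fps_const w * ?P)) $ n =
      (1 - fps_X\<^sup>2 * fps_deriv (Abs_fps c)) $ n"
    proof (cases n)
      case 0
      then show ?thesis by (simp add: power2_eq_square mult.assoc)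
    next
      case (Suc m)
      have "(Abs_fps c * ?P) $ m = (\<Sum>k\<le>m. c k * poly (faber_poly c (m - k)) w)"
        by (simp add: fps_mult_nth atMost_atLeast0)
      then show ?thesis
        by (cases m) (simp_all add: Suc power2_eq_square mult.assoc poly_sum del: of_nat_Suc)
    qed
  qed
qed

text \<open>
  These are the coefficients of \<open>p E' / (1 - E)\<close> with \<open>E = t\<^sub>1 p + t\<^sub>2 p\<^sup>2 + \<dots>\<close>. The explicit recursion
  shows that each is a polynomial without constant term in finitely many \<open>t\<^sub>k\<close>, which is
  what lets holomorphy in a parameter pass from the \<open>t\<^sub>k\<close> to them.
\<close>

fun faber_rem :: "(nat \<Rightarrow> 'a::comm_ring_1) \<Rightarrow> nat \<Rightarrow> 'a" where
  "faber_rem t 0 = 0"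
| "faber_rem t (Suc n) =
     of_nat (Suc n) * t (Suc n) + (\<Sum>k\<le>n. t (Suc k) * faber_rem t (n - k))"

lemma faber_rem_generating_function:
  fixes t :: "nat \<Rightarrow> 'a::comm_ring_1"
  defines "E \<equiv> fps_X * Abs_fps (\<lambda>k. t (Suc k))"
  shows "Abs_fps (faber_rem t) * (1 - E) = fps_X * fps_deriv E"
proof -
  define A where "A = Abs_fps (faber_rem t)"
  have "A = fps_X * fps_deriv E + fps_X * (Abs_fps (\<lambda>k. t (Suc k)) * A)"
  proof (rule fps_ext)
    fix n
    show "A $ n = (fps_X * fps_deriv E + fps_X * (Abs_fps (\<lambda>k. t (Suc k)) * A)) $ n"
    proof (cases n)
      case 0
      then show ?thesis by (simp add: A_def)
    next
      case (Suc m)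
      have "(Abs_fps (\<lambda>k. t (Suc k)) * A) $ m = (\<Sum>k\<le>m. t (Suc k) * faber_rem t (m - k))"
        by (simp add: A_def fps_mult_nth atMost_atLeast0)
      then show ?thesis
        by (cases m) (simp_all add: Suc A_def E_def algebra_simps)
    qed
  qed
  then have "A = fps_X * fps_deriv E + A * E"
    by (simp add: E_def mult_ac)
  then show ?thesis
    unfolding A_def[symmetric] by (simp add: algebra_simps)
qed

text \<open>
  The hypothesis is the only property of the tails \<open>t\<^sub>k = c\<^sub>k q + c\<^sub>k\<^sub>+\<^sub>1 q\<^sup>2 + \<dots>\<close> that the factorisation of
  \<open>H\<close> requires, so the argument is purely formal in \<open>p\<close>, with \<open>q\<close> a fixed nonzero scalar. Instead of
  dividing by \<open>H\<close>, the proof checks that both candidate generating functions have the same product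
  with \<open>H\<close> and cancels.
\<close>

lemma poly_faber_poly_eq:
  fixes c t :: "nat \<Rightarrow> 'a::field"
  assumes "q \<noteq> 0"
    and tail: "\<And>k. t k = q * (c k + t (Suc k))"
  shows "poly (faber_poly c n) (inverse q + inverse q * t 0) = inverse q ^ n + faber_rem t n"
proof -
  define u where "u = inverse q"
  define w where "w = u + u * t 0"
  define C where "C = Abs_fps c"
  define E where "E = fps_X * Abs_fps (\<lambda>k. t (Suc k))"
  define H where "H = 1 + fps_X * (C - fps_const w)"
  define L where "L = 1 - fps_const u * fps_X"
  define S where "S = Abs_fps (\<lambda>n. u ^ n)"
  define A where "A = Abs_fps (faber_rem t)"
  have ut: "u * t k = c k + t (Suc k)" for k
    using \<open>q \<noteq> 0\<close> by (subst tail) (simp add: u_def)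
  \<comment> \<open>\<open>H\<close> vanishes at \<open>p = q\<close>; division by \<open>1 - p/q\<close> leaves the tails as coefficients.\<close>
  have H: "H = L * (1 - E)"
  proof (rule fps_ext)
    fix n
    have "L * (1 - E) = 1 - fps_X * (fps_const u + Abs_fps (\<lambda>k. t (Suc k)) 
        - fps_X * (fps_const u * Abs_fps (\<lambda>k. t (Suc k))))"
      by (simp add: L_def E_def algebra_simps)
    then show "H $ n = (L * (1 - E)) $ n"
      using ut by (cases n; cases "n - 1") (simp_all add: H_def C_def w_def)
  qed
  have S: "S * L = 1"
  proof (rule fps_ext)
    fix n
    have "S * L = S - fps_X * (fps_const u * S)"
      by (simp add: L_def algebra_simps)
    then show "(S * L) $ n = 1 $ n"
      by (cases n) (simp_all add: S_def)
  qed
  have A: "A * (1 - E) = fps_X * fps_deriv E"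
    unfolding A_def E_def by (rule faber_rem_generating_function)
  have "(S + A) * H = (S * L) * (1 - E) + L * (A * (1 - E))"
    by (simp add: H algebra_simps)
  also have "\<dots> = (1 - E) + L * (fps_X * fps_deriv E)"
    by (simp add: S A)
  \<comment> \<open>The product rule for \<open>H = L (1 - E)\<close>, using \<open>L - p L' = 1\<close>.\<close>
  also have "\<dots> = H - fps_X * fps_deriv H"
    by (simp add: H L_def algebra_simps)
  also have "\<dots> = 1 - fps_X\<^sup>2 * fps_deriv C"
    by (simp add: H_def algebra_simps power2_eq_square)
  also have "\<dots> = Abs_fps (\<lambda>n. poly (faber_poly c n) w) * H"
    unfolding C_def H_def by (rule faber_poly_generating_function[symmetric])
  finally have "(S + A) * H = Abs_fps (\<lambda>n. poly (faber_poly c n) w) * H" .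
  moreover have "H $ 0 \<noteq> 0"
    by (simp add: H_def)
  then have "H \<noteq> 0"
    by fastforce
  ultimately have "S + A = Abs_fps (\<lambda>n. poly (faber_poly c n) w)"
    by simp
  then have "(S + A) $ n = poly (faber_poly c n) w"
    by simp
  then show ?thesis
    by (simp add: S_def A_def w_def u_def)
qed

section \<open>Convergence\<close>

text \<open>
  The quotient may have a pole at any zero of the denominator, so only some unspecified radius
  can be claimed. In the application this radius depends on \<open>z\<^sub>2\<close>; it is the source of the condition
  that \<open>Im z\<^sub>1\<close> be large relative to \<open>z\<^sub>2\<close>.
\<close>

lemma fps_divide_sums_near_0:
  fixes F G :: "'a::{banach, real_normed_field} fps"
  assumes "fps_conv_radius F > 0" "fps_conv_radius G > 0" "G $ 0 \<noteq> 0"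
  obtains r :: real where "r > 0"
    "\<And>x. norm x < r \<Longrightarrow> eval_fps G x \<noteq> 0"
    "\<And>x. norm x < r \<Longrightarrow> (\<lambda>n. (F / G) $ n * x ^ n) sums (eval_fps F x / eval_fps G x)"
proof -
  have *: "(\<lambda>x. eval_fps F x / eval_fps G x) has_fps_expansion (F / G)"
    using assms by (intro has_fps_expansion_divide' eval_fps_has_fps_expansion)
  have "isCont (eval_fps G) 0"
    using assms(2) by (intro continuous_eval_fps) (simp add: zero_ereal_def)
  then have "(eval_fps G \<longlongrightarrow> G $ 0) (nhds 0)"
    by (simp add: isCont_def tendsto_nhds_iff eval_fps_at_0)
  then have "eventually (\<lambda>x. eval_fps G x \<noteq> 0) (nhds 0)"
    using assms(3) by (rule tendsto_imp_eventually_ne)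
  moreover have "eventually (\<lambda>x. eval_fps (F / G) x = eval_fps F x / eval_fps G x) (nhds 0)"
    using * by (simp add: has_fps_expansion_def)
  moreover have "eventually (\<lambda>x. x \<in> eball 0 (fps_conv_radius (F / G))) (nhds 0)"
    using * by (intro eventually_nhds_in_open) (auto simp: has_fps_expansion_def zero_ereal_def)
  ultimately have "eventually (\<lambda>x. eval_fps G x \<noteq> 0 \<and>
      (\<lambda>n. (F / G) $ n * x ^ n) sums (eval_fps F x / eval_fps G x)) (nhds 0)"
    by eventually_elim (metis in_eball_iff dist_0_norm sums_eval_fps)
  then show ?thesis
    using that by (auto simp: eventually_nhds_metric)
qed

text \<open>
  Multiplied by \<open>x\<close>, this is the relation between consecutive tails that \<open>poly_faber_poly_eq\<close>
  asks for.
\<close>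

lemma eval_fps_shift_step:
  fixes F :: "'a::{banach, real_normed_field} fps"
  assumes "norm x < fps_conv_radius F"
  shows "eval_fps (fps_shift k F) x = F $ k + x * eval_fps (fps_shift (Suc k) F) x"
proof -
  have "fps_shift k F = fps_const (F $ k) + fps_X * fps_shift (Suc k) F"
  proof (rule fps_ext)
    fix n
    show "fps_shift k F $ n = (fps_const (F $ k) + fps_X * fps_shift (Suc k) F) $ n"
      by (cases n) simp_all
  qed
  moreover have "norm x < fps_conv_radius (fps_X * fps_shift (Suc k) F)"
    using assms fps_conv_radius_mult[of fps_X "fps_shift (Suc k) F"] by (simp add: less_le_trans)
  ultimately show ?thesis
    using assms by (simp add: eval_fps_add eval_fps_mult)
qed

lemma holomorphic_faber_rem:
  assumes "\<And>k. (\<lambda>x. t x k) holomorphic_on A"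
  shows "(\<lambda>x. faber_rem (t x) n) holomorphic_on A"
proof (induction n rule: less_induct)
  case (less n)
  show ?case
  proof (cases n)
    case 0
    then show ?thesis by simp
  next
    case (Suc m)
    then show ?thesis
      using less assms by (auto simp del: of_nat_Suc intro!: holomorphic_intros)
  qed
qed

lemma faber_rem_zero: "faber_rem (\<lambda>_. 0) n = 0"
  by (cases n) simp_all

section \<open>The nome\<close>

lemma norm_nome: "norm (nome z) = exp (- (2 * pi * Im z))"
  by (simp add: nome_def)

lemma nome_nonzero: "nome z \<noteq> 0"
  by (simp add: nome_def)

lemma norm_nome_less_1: "z \<in> upper_half_plane \<Longrightarrow> norm (nome z) < 1"
  by (simp add: norm_nome upper_half_plane_def)

lemma norm_nome_less: 
  assumes "r > 0" "Im z > - ln r / (2 * pi)"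
  shows "norm (nome z) < r"
proof -
  have "- (2 * pi * Im z) < ln r"
    using assms by (simp add: field_simps)
  then have "exp (- (2 * pi * Im z)) < exp (ln r)"
    by (simp only: exp_less_cancel_iff)
  with \<open>r > 0\<close> show ?thesis
    by (simp add: norm_nome)
qed

lemma has_field_derivative_nome:
  "(nome has_field_derivative 2 * of_real pi * \<i> * nome z) (at z)"
  unfolding nome_def by (auto intro!: derivative_eq_intros)

text \<open>
  A power series known to converge at all nomes therefore converges at points of every modulus
  below 1, so its radius of convergence is at least 1.
\<close>

lemma nome_of_real:
  assumes "0 < r" "r < 1"
  shows "\<exists>z\<in>upper_half_plane. nome z = of_real r"
proof
  define z where "z = \<i> * of_real (- ln r / (2 * pi))"
  show "z \<in> upper_half_plane"
    using assms by (simp add: z_def upper_half_plane_def field_simps ln_less_zero)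
  have "2 * of_real pi * \<i> * z = of_real (ln r)"
    by (simp add: z_def field_simps)
  then show "nome z = of_real r"
    using assms by (simp add: nome_def exp_of_real)
qed

section \<open>Expansion of the logarithmic derivative of a Hauptmodul\<close>

theorem corollary1p9:
  fixes N :: nat and hm :: "complex \<Rightarrow> complex"
  assumes "N > 0"
    and "genus_zero N"
    and "hauptmodul N hm"
  shows "\<exists>P :: nat \<Rightarrow> complex poly.
    (\<forall>n\<ge>1. degree (P n) = n) \<and>
    (\<forall>z2\<in>upper_half_plane. \<exists>T>0. \<forall>z1. Im z1 > T \<longrightarrow>
       hm z1 \<noteq> hm z2 \<and>
       summable (\<lambda>n. poly (P (Suc n)) (hm z2) * nome z1 ^ Suc n) \<and>
       - (1 / (2 * of_real pi * \<i>)) * (deriv hm z1 / (hm z1 - hm z2)) =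
         1 + (\<Sum>n. poly (P (Suc n)) (hm z2) * nome z1 ^ Suc n)) \<and>
    (\<forall>n\<ge>1. \<exists>a :: nat \<Rightarrow> complex. \<forall>z2\<in>upper_half_plane.
       (\<lambda>m. a m * nome z2 ^ Suc m) sums (poly (P n) (hm z2) - inverse (nome z2) ^ n))"
proof -
  obtain c :: "nat \<Rightarrow> complex" where
    c: "\<And>z. z \<in> upper_half_plane \<Longrightarrow> (\<lambda>n. c n * nome z ^ n) sums (hm z - inverse (nome z))"
    using assms(3) unfolding hauptmodul_def by blast
  define C where "C = Abs_fps c"
  have radius: "fps_conv_radius C \<ge> 1"
    unfolding fps_conv_radius_def
  proof (rule conv_radius_geI_ex')
    fix r :: real assume "0 < r" "ereal r < 1"
    then obtain z where "z \<in> upper_half_plane" "nome z = of_real r"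
      using nome_of_real by auto
    with c[of z] show "summable (\<lambda>n. C $ n * of_real r ^ n)"
      by (auto simp: C_def sums_iff)
  qed
  have in_disc: "ereal (norm x) < fps_conv_radius C" if "norm x < 1" for x
    using that radius by (metis ereal_less(3) order_less_le_trans)
  have hm_eq: "hm z = inverse (nome z) + eval_fps C (nome z)" if "z \<in> upper_half_plane" for z
    using c[OF that] by (simp add: sums_iff eval_fps_def C_def)
  have deriv_hm: "deriv hm z =
      2 * of_real pi * \<i> * (nome z * eval_fps (fps_deriv C) (nome z) - inverse (nome z))"
    if "z \<in> upper_half_plane" for z
  proof (rule DERIV_imp_deriv)
    have "((\<lambda>z. inverse (nome z) + eval_fps C (nome z)) has_field_derivative
        2 * of_real pi * \<i> * (nome z * eval_fps (fps_deriv C) (nome z) - inverse (nome z))) (at z)"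
      using in_disc[OF norm_nome_less_1[OF that]]
      by (auto intro!: derivative_eq_intros has_field_derivative_nome
          DERIV_chain2[OF has_field_derivative_eval_fps]
          simp: nome_nonzero field_simps power2_eq_square)
    moreover have "open upper_half_plane"
      unfolding upper_half_plane_def by (rule open_halfspace_Im_gt)
    ultimately show "(hm has_field_derivative
        2 * of_real pi * \<i> * (nome z * eval_fps (fps_deriv C) (nome z) - inverse (nome z))) (at z)"
      using that by (rule has_field_derivative_transform_within_open) (simp add: hm_eq)
  qed
  show ?thesis
  proof (intro exI[of _ "faber_poly c"] conjI ballI allI impI)
    fix n :: nat
    show "degree (faber_poly c n) = n"
      using degree_lead_coeff_faber_poly by blast
  next
    fix z2 assume "z2 \<in> upper_half_plane"
    define w where "w = hm z2"
    \<comment> \<open>Numerator and denominator of the left-hand side after clearing the pole \<open>1/p\<close>.\<close>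
    define F where "F = 1 - fps_X\<^sup>2 * fps_deriv C"
    define H where "H = 1 + fps_X * (C - fps_const w)"
    have radius_mult: "fps_conv_radius (A * B) \<ge> 1"
      if "fps_conv_radius A \<ge> 1" "fps_conv_radius B \<ge> 1" for A B :: "complex fps"
      using that fps_conv_radius_mult[of A B] by (meson min.boundedI order_trans)
    have radius_deriv: "fps_conv_radius (fps_deriv C) \<ge> 1"
      using fps_conv_radius_deriv[of C] radius by (rule order_trans[rotated])
    have radius_diff: "fps_conv_radius (A - B) \<ge> 1"
      if "fps_conv_radius A \<ge> 1" "fps_conv_radius B \<ge> 1" for A B :: "complex fps"
      using that fps_conv_radius_diff[of A B] by (meson min.boundedI order_trans)
    have radius_add: "fps_conv_radius (A + B) \<ge> 1"
      if "fps_conv_radius A \<ge> 1" "fps_conv_radius B \<ge> 1" for A B :: "complex fps"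
      using that fps_conv_radius_add[of A B] by (meson min.boundedI order_trans)
    have radius_parts: "fps_conv_radius (fps_X\<^sup>2 * fps_deriv C) \<ge> 1"
        "fps_conv_radius (C - fps_const w) \<ge> 1"
        "fps_conv_radius (fps_X * (C - fps_const w)) \<ge> 1"
      by (intro radius_mult radius_diff radius radius_deriv; simp add: power2_eq_square radius_mult)+
    have radii: "fps_conv_radius F \<ge> 1" "fps_conv_radius H \<ge> 1"
      unfolding F_def H_def by (intro radius_add radius_diff radius_parts; simp)+
    have lt: "ereal (norm x) < fps_conv_radius A" if "norm x < 1" "fps_conv_radius A \<ge> 1"
      for x and A :: "complex fps"
      using that by (metis ereal_less(3) order_less_le_trans)
    have eval_F: "eval_fps F x = 1 - x\<^sup>2 * eval_fps (fps_deriv C) x" if "norm x < 1" for x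
      unfolding F_def using that radius_parts radius_deriv
      by (simp add: eval_fps_diff eval_fps_mult eval_fps_power lt)
    have eval_H: "eval_fps H x = 1 + x * (eval_fps C x - w)" if "norm x < 1" for x
      unfolding H_def using that radius_parts radius
      by (simp add: eval_fps_diff eval_fps_mult eval_fps_add lt)
    have H0: "H $ 0 = 1"
      by (simp add: H_def)
    then have "H \<noteq> 0"
      by fastforce
    have quot: "F / H = Abs_fps (\<lambda>n. poly (faber_poly c n) w)"
      using faber_poly_generating_function[of c w] \<open>H \<noteq> 0\<close>
      unfolding F_def H_def C_def by (metis nonzero_mult_div_cancel_right)
    have "fps_conv_radius F > 0" "fps_conv_radius H > 0" "H $ 0 \<noteq> 0"
      using radii H0 less_le_trans[of "0 :: ereal" 1] by simp_all
    then obtain r where r: "r > 0" "\<And>x. norm x < r \<Longrightarrow> eval_fps H x \<noteq> 0"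
      "\<And>x. norm x < r \<Longrightarrow> (\<lambda>n. (F / H) $ n * x ^ n) sums (eval_fps F x / eval_fps H x)"
      by (rule fps_divide_sums_near_0) blast
    define T where "T = max 1 (- ln r / (2 * pi))"
    show "\<exists>T>0. \<forall>z1. Im z1 > T \<longrightarrow>
       hm z1 \<noteq> hm z2 \<and>
       summable (\<lambda>n. poly (faber_poly c (Suc n)) (hm z2) * nome z1 ^ Suc n) \<and>
       - (1 / (2 * of_real pi * \<i>)) * (deriv hm z1 / (hm z1 - hm z2)) =
         1 + (\<Sum>n. poly (faber_poly c (Suc n)) (hm z2) * nome z1 ^ Suc n)"
    proof (intro exI[of _ T] conjI[of "T > 0"] allI impI)
      show "T > 0" by (simp add: T_def)
    next
      fix z1 assume "Im z1 > T"
      then have z1: "z1 \<in> upper_half_plane" and p_r: "norm (nome z1) < r"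
        using norm_nome_less[OF \<open>r > 0\<close>] by (auto simp: T_def upper_half_plane_def)
      define p where "p = nome z1"
      have p: "p \<noteq> 0" "norm p < 1" "norm p < r"
        using norm_nome_less_1[OF z1] p_r by (auto simp: p_def nome_nonzero)
      have diff: "hm z1 - w = eval_fps H p / p"
        using p(1) hm_eq[OF z1] eval_H[OF p(2)] by (simp add: p_def field_simps)
      then have "hm z1 - w \<noteq> 0"
        using p r(2) by simp
      have "- (1 / (2 * of_real pi * \<i>)) * deriv hm z1 = inverse p - p * eval_fps (fps_deriv C) p"
        unfolding deriv_hm[OF z1] p_def by simp
      also have "\<dots> = eval_fps F p / p"
        unfolding eval_F[OF p(2)] using p(1) by (simp add: field_simps power2_eq_square)
      finally have "- (1 / (2 * of_real pi * \<i>)) * deriv hm z1 = eval_fps F p / p" .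
      then have quotient: "- (1 / (2 * of_real pi * \<i>)) * (deriv hm z1 / (hm z1 - w)) =
          eval_fps F p / eval_fps H p"
        unfolding diff using p(1) by (metis nonzero_divide_mult_cancel_right divide_divide_eq_left
            divide_divide_eq_right nonzero_eq_divide_eq times_divide_eq_right)
      have "(\<lambda>n. poly (faber_poly c n) w * p ^ n) sums (eval_fps F p / eval_fps H p)"
        using r(3)[OF p(3)] by (simp add: quot)
      then have sums: "(\<lambda>n. poly (faber_poly c (Suc n)) w * p ^ Suc n) sums
          (eval_fps F p / eval_fps H p - 1)"
        by (subst sums_Suc_iff) simp
      then show "hm z1 \<noteq> hm z2 \<and>
         summable (\<lambda>n. poly (faber_poly c (Suc n)) (hm z2) * nome z1 ^ Suc n) \<and>
         - (1 / (2 * of_real pi * \<i>)) * (deriv hm z1 / (hm z1 - hm z2)) =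
           1 + (\<Sum>n. poly (faber_poly c (Suc n)) (hm z2) * nome z1 ^ Suc n)"
        using \<open>hm z1 - w \<noteq> 0\<close> quotient
        by (simp add: w_def[symmetric] p_def[symmetric] sums_iff del: power_Suc faber_poly.simps)
    qed
  next
    fix n :: nat
    \<comment> \<open>The remainder is studied as a function of \<open>q\<close> on the whole disc, where its value at 0 makes sense.\<close>
    define t where "t = (\<lambda>q k. q * eval_fps (fps_shift k C) q)"
    define R where "R = (\<lambda>q. faber_rem (t q) n)"
    have "(\<lambda>q. t q k) holomorphic_on ball 0 1" for k
      unfolding t_def using in_disc by (auto intro!: holomorphic_intros)
    then have hol: "R holomorphic_on ball 0 1"
      unfolding R_def by (rule holomorphic_faber_rem)
    define b where "b = (\<lambda>m. (deriv ^^ m) R 0 / fact m)"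
    have b0: "b 0 = 0"
      by (simp add: b_def R_def t_def faber_rem_zero)
    have b: "(\<lambda>m. b m * q ^ m) sums R q" if "norm q < 1" for q
      using holomorphic_power_series[OF hol, of q] that by (simp add: b_def)
    show "\<exists>a. \<forall>z2\<in>upper_half_plane. (\<lambda>m. a m * nome z2 ^ Suc m) sums
        (poly (faber_poly c n) (hm z2) - inverse (nome z2) ^ n)"
    proof (intro exI[of _ "\<lambda>m. b (Suc m)"] ballI)
      fix z2 assume z2: "z2 \<in> upper_half_plane"
      define q where "q = nome z2"
      have q: "q \<noteq> 0" "norm q < 1"
        using norm_nome_less_1[OF z2] by (auto simp: q_def nome_nonzero)
      have "t q k = q * (c k + t q (Suc k))" for k
        using eval_fps_shift_step[OF in_disc[OF q(2)], of k] by (simp add: t_def C_def)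
      then have "poly (faber_poly c n) (inverse q + inverse q * t q 0) = inverse q ^ n + R q"
        unfolding R_def by (rule poly_faber_poly_eq[OF q(1)])
      moreover have "hm z2 = inverse q + inverse q * t q 0"
        using q(1) hm_eq[OF z2] by (simp add: t_def q_def)
      moreover have "(\<lambda>m. b (Suc m) * q ^ Suc m) sums R q"
        using b[OF q(2)] by (subst sums_Suc_iff) (simp add: b0)
      ultimately show "(\<lambda>m. b (Suc m) * nome z2 ^ Suc m) sums
          (poly (faber_poly c n) (hm z2) - inverse (nome z2) ^ n)"
        by (simp add: q_def[symmetric])
    qed
  qed
qed

end
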